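(* Let $R$ be a noetherian ring of (finite Krull) dimension $d>0$. Then $i(R)\geq d-1$.
   Context: All rings are commutative with identity. For an ideal $J$ of a noetherian ring $R$, an element $x\in R$ is integral over $J$ if $x^n+a_1x^{n-1}+\cdots+a_n=0$ for some $n\geq 1$ and $a_i\in J^i$ ($1\le i\le n$); the integral closure $\overline{J}$ is the ideal of all elements integral over $J$. The integral dimension $i(R)$ of a noetherian ring $R$ is the least integer $k\geq 0$ such that $(\overline{J})^n\subseteq J^{n-k}$ for all ideals $J$ of $R$ and all $n\geq k$ (with $J^0=R$), if such a $k$ exists; otherwise $i(R)=\infty$. *)

theory Defs
  imports "HOL-Algebra.Algebra" "HOL-Library.Extended_Nat"
begin

text \<open>Powers of ideals are the library's powers in the multiplicative monoid of
  \<^const>\<open>ideals_set\<close>, whose unit is the whole ring, so that the zeroth power of any ideal is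
  the carrier.\<close>

abbreviation ideal_pow :: "('a, 'b) ring_scheme \<Rightarrow> 'a set \<Rightarrow> nat \<Rightarrow> 'a set"
  where "ideal_pow R J n \<equiv> J [^]\<^bsub>ideals_set R\<^esub> n"

definition integral_over_ideal :: "('a, 'b) ring_scheme \<Rightarrow> 'a set \<Rightarrow> 'a \<Rightarrow> bool"
  where "integral_over_ideal R J x \<longleftrightarrow>
    (\<exists>n a. n \<ge> 1 \<and> (\<forall>i\<in>{1..n}. a i \<in> ideal_pow R J i) \<and>
       x [^]\<^bsub>R\<^esub> n \<oplus>\<^bsub>R\<^esub> (\<Oplus>\<^bsub>R\<^esub>i\<in>{1..n}. a i \<otimes>\<^bsub>R\<^esub> x [^]\<^bsub>R\<^esub> (n - i)) = \<zero>\<^bsub>R\<^esub>)"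

definition integral_closure :: "('a, 'b) ring_scheme \<Rightarrow> 'a set \<Rightarrow> 'a set"
  where "integral_closure R J = {x \<in> carrier R. integral_over_ideal R J x}"

definition integral_dim_bound :: "('a, 'b) ring_scheme \<Rightarrow> nat \<Rightarrow> bool"
  where "integral_dim_bound R k \<longleftrightarrow>
    (\<forall>J n. ideal J R \<longrightarrow> n \<ge> k \<longrightarrow>
       ideal_pow R (integral_closure R J) n \<subseteq> ideal_pow R J (n - k))"

definition integral_dim :: "('a, 'b) ring_scheme \<Rightarrow> enat"
  where "integral_dim R =
    (if \<exists>k. integral_dim_bound R k then enat (LEAST k. integral_dim_bound R k) else \<infinity>)"

definition prime_chain :: "('a, 'b) ring_scheme \<Rightarrow> (nat \<Rightarrow> 'a set) \<Rightarrow> nat \<Rightarrow> bool"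
  where "prime_chain R P n \<longleftrightarrow>
    (\<forall>i\<le>n. primeideal (P i) R) \<and> (\<forall>i<n. P i \<subset> P (Suc i))"

text \<open>As \<^typ>\<open>enat\<close> has no negative elements, the zero ring receives dimension 0.\<close>

definition krull_dim :: "('a, 'b) ring_scheme \<Rightarrow> enat"
  where "krull_dim R = Sup {enat n |n. \<exists>P. prime_chain R P n}"

end

theory Submission
  imports Defs
begin

text \<open>
  The witness is the classical monomial example for regular sequences,
  \<open>J = (x\<^sub>1\<^sup>d, \<dots>, x\<^sub>d\<^sup>d)\<close> and \<open>w = x\<^sub>1 \<cdots> x\<^sub>d\<close>.  Since
  \<open>w\<^sup>d = x\<^sub>1\<^sup>d \<cdots> x\<^sub>d\<^sup>d\<close> lies in the \<open>d\<close>-th power of \<open>J\<close>, the element \<open>w\<close> is integral over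
  \<open>J\<close> and \<open>w\<^bsup>d-1\<^esup>\<close> lies in the \<open>(d-1)\<close>-st power of the integral closure.  If moreover
  \<open>w\<^bsup>d-1\<^esup>\<close> lies outside \<open>J\<close>, then no bound \<open>k \<le> d - 2\<close> is possible: it would put this element
  into \<open>J\<^bsup>d-1-k\<^esup> \<subseteq> J\<close>.

  It remains to find \<open>x\<^sub>1, \<dots>, x\<^sub>d\<close> with \<open>w\<^bsup>d-1\<^esup> \<notin> J\<close>.  For an arbitrary system of parameters
  this is a case of the monomial conjecture, but here the parameters may be chosen one at a time,
  along a chain of primes \<open>P\<^sub>0 \<subset> \<dots> \<subset> P\<^sub>d\<close>.  The invariant is the stronger statement that
  \<open>w\<^bsup>d-1\<^esup>\<close> stays outside \<open>J\<close> even after localizing at \<open>P\<^sub>k\<close>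
  (lemma \<open>prime_chain_monomial\<close>).  Passing from \<open>P\<^sub>k\<close> to \<open>P\<^bsub>k+1\<^esub>\<close>, any
  \<open>y \<in> P\<^bsub>k+1\<^esub>\<close> outside \<open>P\<^sub>k\<close> is a unit at \<open>P\<^sub>k\<close>, so powers of \<open>y\<close> cancel modulo the contraction
  of the localization of \<open>J\<close>, whereas \<open>y\<close> lies in the maximal ideal at \<open>P\<^bsub>k+1\<^esub>\<close>.  By Krull's
  intersection theorem a sufficiently high power \<open>y\<^sup>s\<close> therefore serves as the next parameter
  (lemma \<open>adjoin_parameter\<close>).
\<close>

section \<open>Ideals of a commutative ring\<close>

lemma (in cring) idealI_comm:
  assumes "I \<subseteq> carrier R" and "\<zero> \<in> I"
    and add: "\<And>a b. \<lbrakk>a \<in> I; b \<in> I\<rbrakk> \<Longrightarrow> a \<oplus> b \<in> I"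
    and mult: "\<And>a x. \<lbrakk>a \<in> I; x \<in> carrier R\<rbrakk> \<Longrightarrow> x \<otimes> a \<in> I"
  shows "ideal I R"
proof (rule idealI)
  show "subgroup I (add_monoid R)"
  proof (rule add.subgroupI)
    show "\<ominus> a \<in> I" if "a \<in> I" for a
    proof -
      have "\<ominus> a = (\<ominus> \<one>) \<otimes> a"
        using that assms(1) by (metis l_minus l_one one_closed subsetD)
      then show ?thesis
        using mult[OF that, of "\<ominus> \<one>"] by simp
    qed
  qed (use assms in auto)
  show "a \<otimes> x \<in> I" if "a \<in> I" "x \<in> carrier R" for a x
    using mult[OF that] that assms(1) m_comm by (metis subsetD)
qed (use mult ring_axioms in auto)

lemma (in cring) colon_ideal:
  assumes "ideal I R" and a: "a \<in> carrier R"
  shows "ideal {c \<in> carrier R. a \<otimes> c \<in> I} R"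
proof -
  interpret ideal I R by fact
  show ?thesis
  proof (rule idealI_comm)
    show "x \<otimes> c \<in> {c \<in> carrier R. a \<otimes> c \<in> I}"
      if "c \<in> {c \<in> carrier R. a \<otimes> c \<in> I}" "x \<in> carrier R" for c x
      using that a I_l_closed[of "a \<otimes> c" x] m_lcomm[of a x c] by auto
  qed (use a in \<open>auto simp: r_distr\<close>)
qed

lemma (in cring) add_principal_mem_iff:
  assumes "ideal I R" and a: "a \<in> carrier R" and r: "r \<in> carrier R"
  shows "r \<in> I <+>\<^bsub>R\<^esub> PIdl a \<longleftrightarrow> (\<exists>b\<in>carrier R. r \<ominus> b \<otimes> a \<in> I)"
proof -
  interpret ideal I R by fact
  show ?thesis
  proof
    assume "r \<in> I <+>\<^bsub>R\<^esub> PIdl a"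
    then obtain q b where q: "q \<in> I" and b: "b \<in> carrier R" and r': "r = q \<oplus> b \<otimes> a"
      unfolding set_add_def' cgenideal_def by auto
    have "r \<ominus> b \<otimes> a = q"
      unfolding r' using a b Icarr[OF q] by (simp add: minus_eq a_assoc r_neg)
    then have "r \<ominus> b \<otimes> a \<in> I"
      using q by simp
    then show "\<exists>b\<in>carrier R. r \<ominus> b \<otimes> a \<in> I"
      using b by (rule bexI)
  next
    assume "\<exists>b\<in>carrier R. r \<ominus> b \<otimes> a \<in> I"
    then obtain b where b: "b \<in> carrier R" and q: "r \<ominus> b \<otimes> a \<in> I"
      by auto
    define q where "q = r \<ominus> b \<otimes> a"
    have "r = q \<oplus> b \<otimes> a"
      unfolding q_def using a b r by (simp add: minus_eq a_assoc l_neg)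
    then show "r \<in> I <+>\<^bsub>R\<^esub> PIdl a"
      unfolding set_add_def' cgenideal_def using b q[folded q_def] by auto
  qed
qed

lemma (in cring) subset_add_ideals:
  assumes "ideal I R" and "ideal J R"
  shows "I \<subseteq> I <+>\<^bsub>R\<^esub> J" and "J \<subseteq> I <+>\<^bsub>R\<^esub> J"
proof -
  interpret I: ideal I R by fact
  interpret J: ideal J R by fact
  show "I \<subseteq> I <+>\<^bsub>R\<^esub> J"
  proof
    fix a assume "a \<in> I"
    then have "a \<oplus> \<zero> \<in> I <+>\<^bsub>R\<^esub> J"
      unfolding set_add_def' using J.zero_closed by blast
    then show "a \<in> I <+>\<^bsub>R\<^esub> J"
      using I.Icarr[OF \<open>a \<in> I\<close>] by simp
  qed
  show "J \<subseteq> I <+>\<^bsub>R\<^esub> J"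
  proof
    fix a assume "a \<in> J"
    then have "\<zero> \<oplus> a \<in> I <+>\<^bsub>R\<^esub> J"
      unfolding set_add_def' using I.zero_closed by blast
    then show "a \<in> I <+>\<^bsub>R\<^esub> J"
      using J.Icarr[OF \<open>a \<in> J\<close>] by simp
  qed
qed

section \<open>Powers of ideals\<close>

lemma one_ideals_set [simp]: "\<one>\<^bsub>ideals_set R\<^esub> = carrier R"
  by (simp add: ideals_set_def)

lemma mult_ideals_set [simp]: "I \<otimes>\<^bsub>ideals_set R\<^esub> J = ideal_prod R I J"
  by (simp add: ideals_set_def)

lemma ideal_pow_Suc: "ideal_pow R J (Suc n) = ideal_prod R (ideal_pow R J n) J"
  by simp

lemma ideal_prod_mono:
  assumes "I \<subseteq> I'" and "J \<subseteq> J'"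
  shows "ideal_prod R I J \<subseteq> ideal_prod R I' J'"
proof
  fix s assume "s \<in> ideal_prod R I J"
  then show "s \<in> ideal_prod R I' J'"
    by induct (use assms in \<open>auto intro: ideal_prod.intros\<close>)
qed

lemma ideal_pow_mono:
  assumes "I \<subseteq> J"
  shows "ideal_pow R I n \<subseteq> ideal_pow R J n"
  by (induct n) (simp_all add: ideal_prod_mono assms)

lemma (in cring) ideal_pow_ideal:
  assumes "ideal J R"
  shows "ideal (ideal_pow R J n) R"
  by (induct n) (simp_all add: ideal_prod_is_ideal oneideal assms)

lemma (in cring) nat_pow_mem_ideal_pow:
  assumes "x \<in> A"
  shows "x [^] n \<in> ideal_pow R A n"
  using assms by (induct n) (simp_all add: ideal_prod.prod)

text \<open>The equation of integral dependence is \<open>X\<^sup>n - w\<^sup>n = 0\<close>, with all intermediate coefficients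
  zero.\<close>

lemma (in cring) integral_closureI_pow:
  assumes "ideal J R" and w: "w \<in> carrier R" and n: "n \<ge> 1" and wn: "w [^] n \<in> ideal_pow R J n"
  shows "w \<in> integral_closure R J"
proof -
  define a where "a i = (if i = n then \<ominus> (w [^] n) else \<zero>)" for i
  have a_mem: "a i \<in> ideal_pow R J i" for i
  proof -
    interpret Ji: ideal "ideal_pow R J i" R
      using assms(1) by (rule ideal_pow_ideal)
    show ?thesis
      using wn Ji.a_inv_closed Ji.zero_closed unfolding a_def by metis
  qed
  have "(\<Oplus>i\<in>{1..n}. a i \<otimes> w [^] (n - i)) = (\<Oplus>i\<in>{1..n}. if n = i then \<ominus> (w [^] n) else \<zero>)"
    using w by (intro add.finprod_cong') (auto simp: a_def)
  also have "\<dots> = \<ominus> (w [^] n)"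
    using w n by (subst add.finprod_singleton) auto
  finally have "w [^] n \<oplus> (\<Oplus>i\<in>{1..n}. a i \<otimes> w [^] (n - i)) = \<zero>"
    using w by (simp add: r_neg)
  then show ?thesis
    unfolding integral_closure_def integral_over_ideal_def using w n a_mem by blast
qed

section \<open>Contractions of ideals from localizations\<close>

text \<open>For a prime \<open>P\<close> and an ideal \<open>J\<close>, this is the preimage in \<open>R\<close> of the extension of \<open>J\<close> to the
  localization \<open>R\<^sub>P\<close>.  In this form membership in the localized ideal can be discussed without
  constructing \<open>R\<^sub>P\<close>.\<close>

definition loc_contraction :: "('a, 'b) ring_scheme \<Rightarrow> 'a set \<Rightarrow> 'a set \<Rightarrow> 'a set"
  where "loc_contraction R P J = {r \<in> carrier R. \<exists>t\<in>carrier R - P. t \<otimes>\<^bsub>R\<^esub> r \<in> J}"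

lemma (in primeideal) not_mem_mult:
  assumes "a \<in> carrier R - I" and "b \<in> carrier R - I"
  shows "a \<otimes> b \<in> carrier R - I"
  using assms I_prime by auto

lemma (in primeideal) one_not_mem: "\<one> \<in> carrier R - I"
  using I_notcarr one_imp_carrier by auto

lemma (in primeideal) not_mem_pow:
  fixes n :: nat
  assumes "a \<in> carrier R - I"
  shows "a [^] n \<in> carrier R - I"
proof (induct n)
  case (Suc n)
  then show ?case
    using not_mem_mult[OF Suc assms] by simp
qed (use one_not_mem in auto)

lemma (in cring) loc_contraction_ideal:
  assumes "primeideal P R" and "ideal J R"
  shows "ideal (loc_contraction R P J) R"
proof -
  interpret P: primeideal P R by fact
  interpret J: ideal J R by fact
  show ?thesis
  proof (rule idealI_comm)
    show "\<zero> \<in> loc_contraction R P J"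
      unfolding loc_contraction_def using P.one_not_mem by auto
  next
    fix a b assume "a \<in> loc_contraction R P J" "b \<in> loc_contraction R P J"
    then obtain s t where a: "a \<in> carrier R" "s \<in> carrier R - P" "s \<otimes> a \<in> J"
      and b: "b \<in> carrier R" "t \<in> carrier R - P" "t \<otimes> b \<in> J"
      unfolding loc_contraction_def by auto
    have "(s \<otimes> t) \<otimes> (a \<oplus> b) = t \<otimes> (s \<otimes> a) \<oplus> s \<otimes> (t \<otimes> b)"
      using a b by (simp add: r_distr m_ac)
    then have "(s \<otimes> t) \<otimes> (a \<oplus> b) \<in> J"
      using a b J.I_l_closed by auto
    then show "a \<oplus> b \<in> loc_contraction R P J"
      unfolding loc_contraction_def using a b P.not_mem_mult by blast
  next
    fix a x assume "a \<in> loc_contraction R P J" and x: "x \<in> carrier R"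
    then obtain s where a: "a \<in> carrier R" "s \<in> carrier R - P" "s \<otimes> a \<in> J"
      unfolding loc_contraction_def by auto
    have "s \<otimes> (x \<otimes> a) = x \<otimes> (s \<otimes> a)"
      using a x by (simp add: m_lcomm)
    then have "s \<otimes> (x \<otimes> a) \<in> J"
      using a x J.I_l_closed by simp
    then show "x \<otimes> a \<in> loc_contraction R P J"
      unfolding loc_contraction_def using a x by blast
  qed (auto simp: loc_contraction_def)
qed

lemma (in cring) subset_loc_contraction:
  assumes "primeideal P R" and "ideal J R"
  shows "J \<subseteq> loc_contraction R P J"
proof -
  interpret P: primeideal P R by fact
  interpret J: ideal J R by fact
  show ?thesis
    unfolding loc_contraction_def using P.one_not_mem J.Icarr by force
qed

text \<open>Elements outside \<open>P\<close> become units in \<open>R\<^sub>P\<close>, so they are nonzerodivisors modulo the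
  contraction.\<close>

lemma (in cring) loc_contraction_cancel:
  assumes "primeideal P R" and s: "s \<in> carrier R - P" and r: "r \<in> carrier R"
    and sr: "s \<otimes> r \<in> loc_contraction R P J"
  shows "r \<in> loc_contraction R P J"
proof -
  interpret P: primeideal P R by fact
  obtain t where t: "t \<in> carrier R - P" "t \<otimes> (s \<otimes> r) \<in> J"
    using sr unfolding loc_contraction_def by auto
  then have "(t \<otimes> s) \<otimes> r \<in> J"
    using s r by (simp add: m_assoc)
  then show ?thesis
    unfolding loc_contraction_def using P.not_mem_mult[OF t(1) s] r by blast
qed

section \<open>Adjoining one parameter\<close>

text \<open>Krull's intersection theorem for a principal ideal, with denominators in \<open>T\<close>.  The colon ideals
  \<open>(Q + (u)) : y\<^sup>s\<close> increase with \<open>s\<close>, hence stabilize, say at \<open>n\<close>.  Approximating \<open>u\<close> to order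
  \<open>n + 1\<close> gives \<open>t u \<equiv> y\<^bsup>n+1\<^esup> a\<close> modulo \<open>Q\<close>, so \<open>a\<close> lies in the colon ideal for \<open>n + 1\<close> and thus
  in the one for \<open>n\<close>.  Hence \<open>y\<^sup>n a \<equiv> b u\<close>, and multiplying by \<open>y\<close> yields \<open>t u \<equiv> b y u\<close>.\<close>

lemma (in cring) krull_intersection_principal:
  assumes "noetherian_ring R" and "ideal Q R"
    and T: "T \<subseteq> carrier R" and u: "u \<in> carrier R" and y: "y \<in> carrier R"
    and approx: "\<And>s::nat. \<exists>t\<in>T. \<exists>a\<in>carrier R. t \<otimes> u \<ominus> y [^] s \<otimes> a \<in> Q"
  shows "\<exists>t\<in>T. \<exists>b\<in>carrier R. (t \<ominus> b \<otimes> y) \<otimes> u \<in> Q"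
proof -
  interpret noetherian_ring R by fact
  interpret Q: ideal Q R by fact
  define L where "L = Q <+>\<^bsub>R\<^esub> PIdl u"
  interpret L: ideal L R
    unfolding L_def using assms(2) u by (intro add_ideals cgenideal_ideal)
  define K where "K s = {c \<in> carrier R. y [^] s \<otimes> c \<in> L}" for s :: nat
  have K_ideal: "ideal (K s) R" for s
    unfolding K_def using y by (intro colon_ideal L.is_ideal) simp
  have K_Suc: "K s \<subseteq> K (Suc s)" for s
  proof
    fix c assume c: "c \<in> K s"
    have "y [^] Suc s \<otimes> c = y \<otimes> (y [^] s \<otimes> c)"
      using c y by (simp add: K_def m_ac)
    then show "c \<in> K (Suc s)"
      using c y L.I_l_closed by (auto simp: K_def)
  qed
  have K_mono: "K s \<subseteq> K s'" if "s \<le> s'" for s s'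
    using lift_Suc_mono_le[of K, OF K_Suc that] .
  have "K s \<subseteq> K s' \<or> K s' \<subseteq> K s" for s s'
    using K_mono nat_le_linear[of s s'] by blast
  then have "subset.chain {I. ideal I R} (range K)"
    unfolding pred_on.chain_def using K_ideal by blast
  then have "\<Union> (range K) \<in> range K"
    by (intro ideal_chain_is_trivial) auto
  then obtain n where "\<Union> (range K) = K n"
    by auto
  then have stable: "K (Suc n) \<subseteq> K n"
    by blast
  obtain t a where t: "t \<in> T" and a: "a \<in> carrier R" and ta: "t \<otimes> u \<ominus> y [^] Suc n \<otimes> a \<in> Q"
    using approx by blast
  have tR: "t \<in> carrier R"
    using t T by auto
  define p where "p = y [^] Suc n \<otimes> a"
  have p: "p \<in> carrier R"
    using y a by (simp add: p_def)
  have "\<ominus> (t \<otimes> u \<ominus> p) = p \<ominus> t \<otimes> u"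
    using tR u p by (simp add: minus_eq minus_add a_comm)
  then have "p \<ominus> t \<otimes> u \<in> Q"
    using ta Q.a_inv_closed unfolding p_def by metis
  then have "p \<in> L"
    unfolding L_def using add_principal_mem_iff[OF assms(2) u p] tR by blast
  then have "a \<in> K n"
    using stable a unfolding K_def p_def by auto
  then have "y [^] n \<otimes> a \<in> L"
    unfolding K_def by simp
  then obtain b where b: "b \<in> carrier R" and q: "y [^] n \<otimes> a \<ominus> b \<otimes> u \<in> Q"
    unfolding L_def using add_principal_mem_iff[OF assms(2) u, of "y [^] n \<otimes> a"] a y by auto
  have "(t \<ominus> b \<otimes> y) \<otimes> u = (t \<otimes> u \<ominus> p) \<oplus> y \<otimes> (y [^] n \<otimes> a \<ominus> b \<otimes> u)"
  proof -
    define v where "v = y [^] n"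
    have "v \<in> carrier R" using y by (simp add: v_def)
    moreover have "p = v \<otimes> y \<otimes> a" by (simp add: p_def v_def)
    ultimately show ?thesis
      unfolding v_def[symmetric] using tR u y a b by algebra
  qed
  then have "(t \<ominus> b \<otimes> y) \<otimes> u \<in> Q"
    using ta[folded p_def] Q.I_l_closed[OF q y] by simp
  then show ?thesis
    using t b by blast
qed

text \<open>The inductive step.  Take \<open>z = y\<^sup>s\<close> with \<open>y \<in> P'\<close> outside \<open>P\<close>.  If the conclusion failed for
  this \<open>z\<close>, then \<open>z\<^sup>p (t u - z a) \<in> J\<close> for some \<open>t \<notin> P'\<close>, and cancelling \<open>z\<^sup>p\<close> at \<open>P\<close> shows that
  \<open>t u\<close> is a multiple of \<open>y\<^sup>s\<close> modulo the contraction of \<open>J R\<^sub>P\<close>.  If it failed for every \<open>s\<close>, then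
  Krull's intersection theorem would put \<open>(t - b y) u\<close> into that contraction, where \<open>t - b y\<close> is
  outside \<open>P'\<close> and so can be cancelled as well, contradicting the choice of \<open>u\<close>.\<close>

lemma (in cring) adjoin_parameter:
  assumes "noetherian_ring R" and "primeideal P R" and "primeideal P' R" and "P \<subset> P'"
    and "ideal J R" and u: "u \<in> carrier R" "u \<notin> loc_contraction R P J"
  shows "\<exists>z\<in>carrier R. u \<otimes> z [^] p \<notin> loc_contraction R P' (J <+>\<^bsub>R\<^esub> PIdl (z [^] Suc p))"
proof (rule ccontr)
  assume contra: "\<not> ?thesis"
  interpret P: primeideal P R by fact
  interpret P': primeideal P' R by fact
  define Q where "Q = loc_contraction R P J"
  obtain y where y: "y \<in> P'" "y \<notin> P"
    using assms(4) by blast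
  have yR: "y \<in> carrier R"
    using y(1) P'.Icarr by blast
  have "\<exists>t\<in>carrier R - P'. \<exists>a\<in>carrier R. t \<otimes> u \<ominus> y [^] s \<otimes> a \<in> Q" for s :: nat
  proof -
    define z where "z = y [^] s"
    have z: "z \<in> carrier R"
      using yR by (simp add: z_def)
    have zP: "z [^] p \<in> carrier R - P"
      unfolding z_def using y(2) yR by (intro P.not_mem_pow) auto
    obtain t where t: "t \<in> carrier R - P'"
      and mem: "t \<otimes> (u \<otimes> z [^] p) \<in> J <+>\<^bsub>R\<^esub> PIdl (z [^] Suc p)"
      using contra z unfolding loc_contraction_def by blast
    then obtain a where a: "a \<in> carrier R"
      and J: "t \<otimes> (u \<otimes> z [^] p) \<ominus> a \<otimes> z [^] Suc p \<in> J"
      using add_principal_mem_iff[OF assms(5), of "z [^] Suc p" "t \<otimes> (u \<otimes> z [^] p)"] z u(1) by auto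
    have "t \<otimes> (u \<otimes> z [^] p) \<ominus> a \<otimes> z [^] Suc p = z [^] p \<otimes> (t \<otimes> u \<ominus> z \<otimes> a)"
    proof -
      define v where "v = z [^] p"
      have "v \<in> carrier R" using z by (simp add: v_def)
      moreover have "z [^] Suc p = v \<otimes> z" by (simp add: v_def)
      moreover have "t \<in> carrier R" using t by simp
      ultimately show ?thesis
        unfolding v_def[symmetric] using u(1) z a by algebra
    qed
    then have "z [^] p \<otimes> (t \<otimes> u \<ominus> z \<otimes> a) \<in> Q"
      using J subset_loc_contraction[OF assms(2,5)] by (auto simp: Q_def)
    moreover have "t \<otimes> u \<ominus> z \<otimes> a \<in> carrier R"
      using t u(1) z a by simp
    ultimately have "t \<otimes> u \<ominus> z \<otimes> a \<in> Q"
      unfolding Q_def using loc_contraction_cancel[OF assms(2) zP] by blast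
    then show ?thesis
      using t a unfolding z_def by blast
  qed
  then obtain t b where t: "t \<in> carrier R - P'" and b: "b \<in> carrier R"
    and mem: "(t \<ominus> b \<otimes> y) \<otimes> u \<in> Q"
    using krull_intersection_principal[OF assms(1) loc_contraction_ideal[OF assms(2,5)],
        of "carrier R - P'" u y] u(1) yR unfolding Q_def by blast
  \<comment> \<open>Since \<open>y\<close> lies in \<open>P'\<close> and \<open>t\<close> does not, this element is a unit at \<open>P'\<close>, hence at \<open>P\<close>.\<close>
  have "t \<ominus> b \<otimes> y \<in> carrier R - P'"
  proof -
    have by_P': "b \<otimes> y \<in> P'"
      using P'.I_l_closed[OF y(1) b] .
    have "t = (t \<ominus> b \<otimes> y) \<oplus> b \<otimes> y"
      using t b yR by (simp add: minus_eq a_assoc l_neg)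
    then have "t \<ominus> b \<otimes> y \<notin> P'"
      using P'.a_closed[OF _ by_P'] t by (metis DiffD2)
    then show ?thesis
      using t b yR by auto
  qed
  then have "t \<ominus> b \<otimes> y \<in> carrier R - P"
    using assms(4) by blast
  then have "u \<in> Q"
    using loc_contraction_cancel[OF assms(2) _ u(1)] mem unfolding Q_def by blast
  then show False
    using u(2) by (simp add: Q_def)
qed

section \<open>Chains of primes and the lower bound\<close>

text \<open>Here \<open>w\<close> is a product of \<open>k\<close> parameters and \<open>J\<close> is generated by their \<open>(p+1)\<close>-st powers.  The
  exponent \<open>p\<close> is independent of \<open>k\<close>, because the same exponent has to be used for all parameters,
  while it will be specialized to the length of the whole chain minus one.\<close>

lemma (in cring) prime_chain_monomial:
  assumes "noetherian_ring R" and "prime_chain R P d" and "k \<le> d"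
  shows "\<exists>J w. ideal J R \<and> w \<in> carrier R \<and> w [^] Suc p \<in> ideal_pow R J k
           \<and> w [^] p \<notin> loc_contraction R (P k) J"
  using assms(3)
proof (induct k)
  case 0
  interpret P0: primeideal "P 0" R
    using assms(2) by (simp add: prime_chain_def)
  have "\<one> [^] p \<notin> loc_contraction R (P 0) {\<zero>}"
    unfolding loc_contraction_def by auto
  moreover have "\<one> [^] Suc p \<in> ideal_pow R {\<zero>} 0"
    by simp
  ultimately show ?case
    using zeroideal one_closed by blast
next
  case (Suc k)
  then obtain J w where J: "ideal J R" and w: "w \<in> carrier R"
    and wJ: "w [^] Suc p \<in> ideal_pow R J k" and wP: "w [^] p \<notin> loc_contraction R (P k) J"
    by auto
  have "primeideal (P k) R" "primeideal (P (Suc k)) R" "P k \<subset> P (Suc k)"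
    using assms(2) Suc.prems by (auto simp: prime_chain_def)
  then obtain z where z: "z \<in> carrier R"
    and zP: "w [^] p \<otimes> z [^] p \<notin> loc_contraction R (P (Suc k)) (J <+>\<^bsub>R\<^esub> PIdl (z [^] Suc p))"
    using adjoin_parameter[OF assms(1) _ _ _ J _ wP] w by blast
  define J' where "J' = J <+>\<^bsub>R\<^esub> PIdl (z [^] Suc p)"
  have Z: "ideal (PIdl (z [^] Suc p)) R"
    using z by (intro cgenideal_ideal) simp
  have "z [^] Suc p \<in> J'"
    using subset_add_ideals(2)[OF J Z] cgenideal_self[of "z [^] Suc p"] z
    unfolding J'_def by auto
  moreover have "w [^] Suc p \<in> ideal_pow R J' k"
    using wJ ideal_pow_mono[OF subset_add_ideals(1)[OF J Z]] unfolding J'_def by blast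
  ultimately have "w [^] Suc p \<otimes> z [^] Suc p \<in> ideal_pow R J' (Suc k)"
    unfolding ideal_pow_Suc by (intro ideal_prod.prod)
  then have "(w \<otimes> z) [^] Suc p \<in> ideal_pow R J' (Suc k)"
    using w z by (simp only: nat_pow_distrib)
  moreover have "(w \<otimes> z) [^] p \<notin> loc_contraction R (P (Suc k)) J'"
    using zP w z unfolding J'_def by (simp only: nat_pow_distrib not_False_eq_True)
  moreover have "ideal J' R"
    unfolding J'_def using J Z by (rule add_ideals)
  moreover have "w \<otimes> z \<in> carrier R"
    using w z by simp
  ultimately show ?case
    by (intro exI[of _ J'] exI[of _ "w \<otimes> z"] conjI)
qed

text \<open>With \<open>p = d - 1\<close> the two exponents in \<open>w\<^bsup>p+1\<^esup> \<in> J\<^sup>d\<close> agree, which is what makes \<open>w\<close> integral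
  over \<open>J\<close>.\<close>

lemma (in cring) integral_dim_bound_prime_chain:
  assumes "noetherian_ring R" and "prime_chain R P d"
    and bound: "integral_dim_bound R k"
  shows "d \<le> k + 1"
proof (rule ccontr)
  assume "\<not> d \<le> k + 1"
  then obtain p where d: "d = Suc p" and kp: "k < p"
    by (cases d) auto
  obtain J w where J: "ideal J R" and w: "w \<in> carrier R"
    and wd: "w [^] d \<in> ideal_pow R J d" and wp: "w [^] p \<notin> loc_contraction R (P d) J"
    using prime_chain_monomial[OF assms(1,2) order_refl, of p] unfolding d by blast
  have "primeideal (P d) R"
    using assms(2) by (simp add: prime_chain_def)
  then have wJ: "w [^] p \<notin> J"
    using wp subset_loc_contraction[OF _ J] by blast
  have "w \<in> integral_closure R J"
    using integral_closureI_pow[OF J w _ wd] d by simp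
  then have "w [^] p \<in> ideal_pow R (integral_closure R J) p"
    by (rule nat_pow_mem_ideal_pow)
  also have "\<dots> \<subseteq> ideal_pow R J (p - k)"
    using bound J kp unfolding integral_dim_bound_def by auto
  also have "\<dots> \<subseteq> J"
  proof -
    obtain q where q: "p - k = Suc q"
      using kp by (metis Suc_diff_Suc)
    show ?thesis
      unfolding q ideal_pow_Suc using ideal_prod_inter[OF ideal_pow_ideal[OF J] J] by blast
  qed
  finally show False
    using wJ by simp
qed

text \<open>A finite supremum in \<^typ>\<open>enat\<close> is a maximum unless the set is empty.  For \<open>d = 0\<close> the zero ring
  is an exception.\<close>

lemma krull_dim_attained:
  assumes "krull_dim R = enat d" and "d > 0"
  shows "\<exists>P. prime_chain R P d"
proof -
  let ?A = "{enat n |n. \<exists>P. prime_chain R P n}"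
  have "?A \<noteq> {}" "finite ?A"
    using assms unfolding krull_dim_def Sup_enat_def
    by (auto split: if_splits simp: zero_enat_def)
  then have "Sup ?A \<in> ?A"
    unfolding Sup_enat_def using Max_in[of ?A] by presburger
  then show ?thesis
    using assms(1) unfolding krull_dim_def by auto
qed

theorem proposition2p10:
  fixes R :: "('a, 'b) ring_scheme" and d :: nat
  assumes "cring R" and "noetherian_ring R"
    and "krull_dim R = enat d" and "d > 0"
  shows "integral_dim R \<ge> enat (d - 1)"
proof (cases "\<exists>k. integral_dim_bound R k")
  case True
  obtain P where "prime_chain R P d"
    using krull_dim_attained[OF assms(3,4)] by blast
  then have "d - 1 \<le> (LEAST k. integral_dim_bound R k)"
    using cring.integral_dim_bound_prime_chain[OF assms(1,2)] LeastI_ex[OF True] by fastforce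
  then show ?thesis
    using True by (simp add: integral_dim_def)
qed (simp add: integral_dim_def)

end
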